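(* For every integer $n \geq 1$, let $\ell$ be the positive integer with $\ell^2\leq n<(\ell+1)^2$. Then \[ \sum_{\pi \in \mathcal{D}_2(n)} (-1)^{\# (\pi)-s_2(\pi)}= \begin{cases} (-1)^{\ell-1}+(-1)^{j} & \text{if } n= \frac{j(3j\pm 1)}{2} \text{ for some positive integer } j, \\ (-1)^{\ell - 1} & \text{if } n \text{ is not of the form } \frac{j(3j\pm 1)}{2} \text{ with } j \text{ a positive integer}. \end{cases} \]
   Context: $\mathcal{D}_2(n)$ denotes the set of partitions of $n$ into distinct parts having at least two parts; for such $\pi$, $\#(\pi)$ is the number of parts and $s_2(\pi)$ is the second smallest part. *)

theory Defs
  imports Complex_Main
begin

text \<open>A partition into distinct parts is identified with the finite set of its parts,
  so the number of parts is the cardinality and the number partitioned is the sum of the set.\<close>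

definition D2 :: "nat \<Rightarrow> nat set set" where
  "D2 n = {\<pi>. finite \<pi> \<and> (\<forall>p\<in>\<pi>. 0 < p) \<and> \<Sum>\<pi> = n \<and> 2 \<le> card \<pi>}"

definition s2 :: "nat set \<Rightarrow> nat" where
  "s2 \<pi> = Min (\<pi> - {Min \<pi>})"

text \<open>Finiteness is needed for \<^const>\<open>sum\<close> over \<^term>\<open>D2 n\<close> to be the actual sum.\<close>

lemma finite_D2: "finite (D2 n)"
proof (rule finite_subset)
  show "D2 n \<subseteq> Pow {..n}"
    by (auto simp: D2_def intro: member_le_sum[where f = "\<lambda>x. x", simplified])
qed simp

end

theory Submission
  imports Defs "HOL-Computational_Algebra.Polynomial"
begin

text \<open>Write \<open>P s\<close> for the product of the \<open>1 - q^i\<close> over \<open>s < i\<close>. Sorting partitions by their second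
  smallest part \<open>s\<close>, the generating function of the left-hand side is
  \<open>F = \<Sum>s. (-1)^s q^s (q + \<dots> + q^(s-1)) P s\<close>. Put \<open>G z = \<Sum>s. z^s P s\<close>. Then \<open>(1 - z) G z = G (z q)\<close>, so
  \<open>(1 - q) F = (1 - q) P 0 - G (-q)\<close> and \<open>G (-q) = \<Prod>i. (1 - q^i)/(1 + q^i)\<close>. By Euler's pentagonal number
  theorem for \<open>P 0\<close> and Gauss's identity \<open>G (-q) = (1 - q) (\<Sum>k. (-1)^k (q^(k^2) + \<dots> + q^(k^2 + 2k)))\<close>,
  dividing by \<open>1 - q\<close> gives the claim. Euler's iterative proof of the pentagonal theorem
  applies verbatim to \<open>\<Prod>i. (1 - q^i)/(1 - b q^i)\<close> and yields both identities, for \<open>b = 0\<close> and \<open>b = -1\<close>.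
  All products and sums are truncated at \<open>M\<close>, and equality is replaced by congruence modulo \<open>q^M\<close>.\<close>

section \<open>Cancellation in congruences modulo powers of \<open>q\<close>\<close>

text \<open>Since \<open>u * a - a\<close> is a multiple of \<open>q * a\<close>, each divisibility
  \<open>q ^ i dvd a\<close> with \<open>i < m\<close> improves to
  \<open>q ^ Suc i dvd a\<close>.\<close>

lemma power_dvd_cancel_unit:
  fixes q :: "'a::comm_ring_1"
  assumes "q ^ m dvd u * a" and "q dvd u - 1"
  shows "q ^ m dvd a"
proof -
  obtain c where c: "u = 1 + q * c"
    using assms(2) by (metis add.commute diff_eq_eq dvdE)
  have "q ^ i dvd a" if "i \<le> m" for i
    using that
  proof (induction i)
    case (Suc i)
    then have "q ^ Suc i dvd q * c * a"
      by (simp add: mult.assoc mult_dvd_mono)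
    moreover have "q ^ Suc i dvd u * a"
      using Suc.prems assms(1) le_imp_power_dvd dvd_trans by blast
    ultimately have "q ^ Suc i dvd u * a - q * c * a"
      by (rule dvd_diff[rotated])
    then show ?case by (simp add: c algebra_simps)
  qed simp
  then show ?thesis by simp
qed

lemma dvd_prod_minus_one:
  fixes q :: "'a::comm_ring_1"
  assumes "finite S" and "\<And>i. i \<in> S \<Longrightarrow> q dvd f i - 1"
  shows "q dvd prod f S - 1"
  using assms
proof (induction S)
  case (insert x S)
  have "prod f (insert x S) - 1 = f x * (prod f S - 1) + (f x - 1)"
    using insert.hyps by (simp add: algebra_simps)
  then show ?case using insert by (metis dvd_add dvd_mult insertCI)
qed simp

section \<open>A finite form of the Rogers-Fine expansion\<close>

text \<open>Multiply the recurrence of \<open>a\<close> by \<open>q ^ (k * Suc i)\<close> and sum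
  over \<open>i < d\<close>. The left side misses the terms at 0, the right side those at
  \<open>d\<close>.\<close>

lemma hypergeometric_sum_shift:
  fixes q b :: "'a::comm_ring_1"
  assumes "\<And>i. i < d \<Longrightarrow> a (Suc i) * (1 - b * q ^ (k + Suc i)) = a i * (1 - q ^ (k + Suc i))"
  shows "(\<Sum>i\<le>d. q ^ (k * i) * a i) - a 0 - b * q ^ k * ((\<Sum>i\<le>d. q ^ (Suc k * i) * a i) - a 0)
       = q ^ k * ((\<Sum>i\<le>d. q ^ (k * i) * a i) - q ^ (k * d) * a d)
         - q ^ (2 * k + 1) * ((\<Sum>i\<le>d. q ^ (Suc k * i) * a i) - q ^ (Suc k * d) * a d)"
  using assms
proof (induction d)
  case (Suc d)
  define x y where "x = q ^ (k * d)" and "y = q ^ d"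
  have e: "q ^ (k * d) = x" "q ^ (k * Suc d) = q ^ k * x" "q ^ (Suc k * d) = x * y" "q ^ (2 * k + 1) = q ^ k * q ^ k * q"
    "q ^ (Suc k * Suc d) = q ^ k * q * x * y" "q ^ (k + Suc d) = q ^ k * q * y"
    by (simp_all add: x_def y_def algebra_simps power_add mult_2 mult_2_right)
  \<comment> \<open>The induction step as a bare ring identity: \<open>A\<close> and
    \<open>B\<close> are the two sums up to \<open>d\<close>, and \<open>c\<close>,
    \<open>v\<close>, \<open>u\<close> are \<open>a 0\<close>, \<open>a d\<close>,
    \<open>a (Suc d)\<close>.\<close>
  have aux: "A + q ^ k * x * u - c - b * q ^ k * (B + q ^ k * q * x * y * u - c)
      = q ^ k * (A + q ^ k * x * u - q ^ k * x * u)
        - q ^ k * q ^ k * q * (B + q ^ k * q * x * y * u - q ^ k * q * x * y * u)"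
    if IH: "A - c - b * q ^ k * (B - c) = q ^ k * (A - x * v) - q ^ k * q ^ k * q * (B - x * y * v)"
      and step: "u * (1 - b * (q ^ k * q * y)) = v * (1 - q ^ k * q * y)" for A B c u v
  proof -
    have "A + q ^ k * x * u - c - b * q ^ k * (B + q ^ k * q * x * y * u - c)
        = (A - c - b * q ^ k * (B - c)) + q ^ k * x * (u * (1 - b * (q ^ k * q * y)))"
      by (simp add: algebra_simps)
    also have "\<dots> = q ^ k * A - q ^ k * q ^ k * q * B"
      unfolding IH step by (simp add: algebra_simps)
    finally show ?thesis by simp
  qed
  have IH: "(\<Sum>i\<le>d. q ^ (k * i) * a i) - a 0 - b * q ^ k * ((\<Sum>i\<le>d. q ^ (Suc k * i) * a i) - a 0)
       = q ^ k * ((\<Sum>i\<le>d. q ^ (k * i) * a i) - x * a d)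
         - q ^ k * q ^ k * q * ((\<Sum>i\<le>d. q ^ (Suc k * i) * a i) - x * y * a d)"
    by (rule Suc.IH[unfolded e]) (rule Suc.prems, simp)
  show ?case
    unfolding sum.atMost_Suc e by (rule aux[OF IH]) (use Suc.prems[of d] e in simp)
qed simp

text \<open>Up to a factor independent of \<open>n\<close>, this is \<open>\<Prod>i\<in>{k<..n}. (1 - q^i)/(1 - b q^i)\<close> with its denominators
  cleared, so that no inverses in the ring are needed. The sums are those of the Rogers--Fine
  identity.\<close>

definition rf_term :: "'a::comm_ring_1 \<Rightarrow> 'a \<Rightarrow> nat \<Rightarrow> nat \<Rightarrow> nat \<Rightarrow> 'a" where
  "rf_term q b M k n = (\<Prod>i\<in>{k<..n}. 1 - q ^ i) * (\<Prod>i\<in>{n<..M}. 1 - b * q ^ i)"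

text \<open>The factor \<open>1 - q ^ k\<close> kills the sum at \<open>k = 0\<close> and otherwise
  matches the factor released by \<open>rf_term_Suc_left\<close>. The default 0 beyond
  \<open>M\<close> ends the recursion.\<close>

definition rf_sum :: "'a::comm_ring_1 \<Rightarrow> 'a \<Rightarrow> nat \<Rightarrow> nat \<Rightarrow> 'a" where
  "rf_sum q b M k = (if k \<le> M then (1 - q ^ k) * (\<Sum>i\<le>M - k. q ^ (k * i) * rf_term q b M k (k + i)) else 0)"

lemma greaterThanAtMost_Suc_left: "k < n \<Longrightarrow> {k<..n} = insert (Suc k) {Suc k<..n}" for k n :: nat
  by auto

lemma greaterThanAtMost_Suc_right: "k \<le> n \<Longrightarrow> {k<..Suc n} = insert (Suc n) {k<..n}" for k n :: nat
  by auto

lemma rf_term_Suc: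
  assumes "k \<le> n" "n < M"
  shows "rf_term q b M k (Suc n) * (1 - b * q ^ Suc n) = rf_term q b M k n * (1 - q ^ Suc n)"
  using assms
  by (simp add: rf_term_def greaterThanAtMost_Suc_left[of n M] greaterThanAtMost_Suc_right mult_ac)

lemma rf_term_Suc_left:
  assumes "k < n"
  shows "rf_term q b M k n = (1 - q ^ Suc k) * rf_term q b M (Suc k) n"
  using assms by (simp add: rf_term_def greaterThanAtMost_Suc_left[of k n] mult_ac)

text \<open>One step of Euler's iteration: \<open>hypergeometric_sum_shift\<close> solved for
  \<open>(1 - q ^ k) * S0\<close>. The last summand is the truncation error from the upper
  end.\<close>

lemma rf_sum_rec:
  fixes q b :: "'a::comm_ring_1"
  assumes "k \<le> M"
  shows "rf_sum q b M k = (\<Prod>i\<in>{k<..M}. 1 - b * q ^ i) * (1 - q ^ (2 * k + 1))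
           + q ^ (2 * k + 1) * (b - q ^ Suc k) * rf_sum q b M (Suc k)
           - rf_term q b M k M * q ^ (k * (M + 1 - k)) * (1 - q ^ (M + 1))"
proof -
  define a d where "a i = rf_term q b M k (k + i)" and "d = M - k" for i
  define S0 S1 where "S0 = (\<Sum>i\<le>d. q ^ (k * i) * a i)" and "S1 = (\<Sum>i\<le>d. q ^ (Suc k * i) * a i)"
  have a0: "a 0 = (\<Prod>i\<in>{k<..M}. 1 - b * q ^ i)" by (simp add: a_def rf_term_def)
  have ad: "a d = rf_term q b M k M" using assms by (simp add: a_def d_def)
  have shift: "S0 - a 0 - b * q ^ k * (S1 - a 0)
     = q ^ k * (S0 - q ^ (k * d) * a d) - q ^ (2 * k + 1) * (S1 - q ^ (Suc k * d) * a d)"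
    unfolding S0_def S1_def
    by (rule hypergeometric_sum_shift) (use rf_term_Suc[of k _ M q b] in \<open>auto simp: a_def d_def\<close>)
  \<comment> \<open>After \<open>i = 0\<close> is split off, every term contains
    \<open>1 - q ^ Suc k\<close>, which turns the rest into the next \<open>rf_sum\<close>.\<close>
  have S1: "S1 = a 0 + q ^ Suc k * rf_sum q b M (Suc k)"
  proof (cases "k < M")
    case True
    then have d: "d = Suc (M - Suc k)" by (simp add: d_def)
    have "S1 = a 0 + (\<Sum>i\<le>M - Suc k. q ^ (Suc k * Suc i) * a (Suc i))"
      unfolding S1_def d sum.atMost_Suc_shift by simp
    also have "(\<Sum>i\<le>M - Suc k. q ^ (Suc k * Suc i) * a (Suc i))
       = (\<Sum>i\<le>M - Suc k. q ^ Suc k * ((1 - q ^ Suc k) * (q ^ (Suc k * i) * rf_term q b M (Suc k) (Suc k + i))))"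
      by (rule sum.cong) (simp_all add: a_def rf_term_Suc_left power_add algebra_simps)
    also have "\<dots> = q ^ Suc k * rf_sum q b M (Suc k)"
      using True unfolding rf_sum_def by (simp only: Suc_le_eq if_True sum_distrib_left)
    finally show ?thesis .
  next
    case False
    then show ?thesis using assms by (simp add: S1_def d_def rf_sum_def)
  qed
  have H: "rf_sum q b M k = (1 - q ^ k) * S0"
    using assms by (simp add: rf_sum_def S0_def a_def d_def)
  have e: "q ^ (k * (M + 1 - k)) = q ^ k * q ^ (k * d)"
    "q ^ (k * (M + 1 - k)) * q ^ (M + 1) = q ^ (2 * k + 1) * q ^ (Suc k * d)"
    using assms by (auto simp: d_def algebra_simps power_add mult_2_right elim!: le_Suc_ex[THEN exE])
  have "(1 - q ^ k) * S0 = (S0 - a 0 - b * q ^ k * (S1 - a 0)) - q ^ k * S0 + a 0 + b * q ^ k * (S1 - a 0)"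
    by (simp add: algebra_simps)
  also have "\<dots> = a 0 * (1 - q ^ (2 * k + 1)) + q ^ k * q ^ Suc k * (b - q ^ Suc k) * rf_sum q b M (Suc k)
      - a d * (q ^ k * q ^ (k * d) - q ^ (2 * k + 1) * q ^ (Suc k * d))"
    unfolding shift unfolding S1 by (simp add: algebra_simps power_add mult_2 mult_2_right)
  also have "\<dots> = a 0 * (1 - q ^ (2 * k + 1)) + q ^ k * q ^ Suc k * (b - q ^ Suc k) * rf_sum q b M (Suc k)
      - a d * q ^ (k * (M + 1 - k)) * (1 - q ^ (M + 1))"
    unfolding e[symmetric] by (simp add: algebra_simps)
  also have "q ^ k * q ^ Suc k = q ^ (2 * k + 1)"
    by (simp add: mult_2 power_add mult.left_commute)
  finally show ?thesis unfolding H ad[symmetric] a0[symmetric] .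
qed

text \<open>Iterate \<open>rf_sum_rec\<close> from \<open>k = 0\<close> up to \<open>M\<close>;
  \<open>T\<close> collects the multipliers of the successive \<open>rf_sum\<close>.\<close>

lemma rogers_fine_expansion:
  fixes q b :: "'a::comm_ring_1"
  defines "T \<equiv> \<lambda>K. \<Prod>k<K. q ^ (2 * k + 1) * (b - q ^ Suc k)"
  shows "q ^ M dvd (\<Prod>i\<in>{0<..M}. 1 - q ^ i)
           - (\<Sum>k\<le>M. (\<Prod>i\<in>{k<..M}. 1 - b * q ^ i) * T k * (1 - q ^ (2 * k + 1)))"
proof -
  define P where "P = (\<Prod>i\<in>{0<..M}. 1 - q ^ i)"
  define t where "t k = (\<Prod>i\<in>{k<..M}. 1 - b * q ^ i) * T k * (1 - q ^ (2 * k + 1))" for k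
  have "q ^ M dvd P - (\<Sum>k\<le>K. t k) - T (Suc K) * rf_sum q b M (Suc K)" if "K \<le> M" for K
    using that
  proof (induction K)
    case 0
    \<comment> \<open>At \<open>k = 0\<close> the left side of the recursion vanishes, so its
      boundary term supplies the product \<open>P\<close>.\<close>
    have "rf_sum q b M 0 = 0" "rf_term q b M 0 M = P"
      by (simp_all add: rf_sum_def rf_term_def P_def)
    with rf_sum_rec[of 0 M q b]
    have "P - t 0 - T (Suc 0) * rf_sum q b M (Suc 0) = q ^ M * (q * P)"
      by (simp add: t_def T_def algebra_simps)
    then show ?case by simp
  next
    case (Suc K)
    obtain r where "M = Suc K + r"
      using Suc.prems le_Suc_ex by blast
    \<comment> \<open>For \<open>1 \<le> k \<le> M\<close> the exponent
      \<open>k * (M + 1 - k)\<close> is at least \<open>M\<close>, so all later truncation errors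
      vanish modulo \<open>q ^ M\<close>.\<close>
    then have "M \<le> Suc K * (M + 1 - Suc K)" by simp
    then have "q ^ M dvd T (Suc K) * (rf_term q b M (Suc K) M * q ^ (Suc K * (M + 1 - Suc K)) * (1 - q ^ (M + 1)))"
      by (intro dvd_mult dvd_mult2 le_imp_power_dvd)
    moreover have "p - (s + N * T' * x) - T' * c * h = p - s - T' * (N * x + c * h - e) - T' * e"
      for p s N T' x c h e :: 'a
      by (simp add: algebra_simps)
    then have "P - (\<Sum>k\<le>Suc K. t k) - T (Suc (Suc K)) * rf_sum q b M (Suc (Suc K))
      = P - (\<Sum>k\<le>K. t k) - T (Suc K) * rf_sum q b M (Suc K)
        - T (Suc K) * (rf_term q b M (Suc K) M * q ^ (Suc K * (M + 1 - Suc K)) * (1 - q ^ (M + 1)))"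
      unfolding sum.atMost_Suc rf_sum_rec[OF Suc.prems] t_def T_def prod.lessThan_Suc[of _ "Suc K"] .
    ultimately show ?case
      using Suc by (metis Suc_leD dvd_diff)
  qed
  from this[of M] show ?thesis
    by (simp add: rf_sum_def P_def t_def)
qed

section \<open>The identities of Euler and Gauss, truncated\<close>

definition pent :: "nat \<Rightarrow> nat" where
  "pent k = k * (3 * k + 1) div 2"

lemma two_pent: "2 * pent k = k * (3 * k + 1)"
  by (simp add: pent_def)

lemma pent_Suc: "pent (Suc k) = pent k + (3 * k + 2)"
  using two_pent[of k] two_pent[of "Suc k"] by (simp add: algebra_simps)

text \<open>Case \<open>b = 0\<close>: the factors of \<open>T\<close> have exponents
  \<open>3 * k + 2\<close>, the gaps between successive values of \<open>pent\<close>.\<close>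

lemma truncated_pentagonal:
  fixes q :: "'a::comm_ring_1"
  shows "q ^ M dvd (\<Prod>i\<in>{0<..M}. 1 - q ^ i) - (\<Sum>k\<le>M. (-1) ^ k * q ^ pent k * (1 - q ^ (2 * k + 1)))"
proof -
  have "(\<Prod>k<K. q ^ (2 * k + 1) * (0 - q ^ Suc k)) = (-1) ^ K * q ^ pent K" for K
  proof (induction K)
    case (Suc K)
    then show ?case
      by (simp add: pent_Suc power_add mult_2 mult_2_right algebra_simps numeral_3_eq_3)
  qed (simp add: pent_def)
  with rogers_fine_expansion[of q M 0] show ?thesis by simp
qed

text \<open>Case \<open>b = -1\<close>: the odd exponents add up to squares, and the factors
  \<open>1 + q ^ i\<close> from \<open>T\<close> complete each partial product to one common
  factor.\<close>

lemma truncated_gauss: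
  fixes q :: "'a::comm_ring_1"
  shows "q ^ M dvd (\<Prod>i\<in>{0<..M}. 1 - q ^ i)
           - (\<Prod>i\<in>{0<..M}. 1 + q ^ i) * (\<Sum>k\<le>M. (-1) ^ k * q ^ k\<^sup>2 * (1 - q ^ (2 * k + 1)))"
proof -
  have T: "(\<Prod>k<K. q ^ (2 * k + 1) * (-1 - q ^ Suc k)) = (-1) ^ K * q ^ K\<^sup>2 * (\<Prod>i\<in>{0<..K}. 1 + q ^ i)" for K
  proof (induction K)
    case (Suc K)
    then show ?case
      by (simp add: greaterThanAtMost_Suc_right power2_eq_square power_add mult_2 mult_2_right algebra_simps)
  qed simp
  have split: "(\<Prod>i\<in>{k<..M}. 1 + q ^ i) * (\<Prod>i\<in>{0<..k}. 1 + q ^ i) = (\<Prod>i\<in>{0<..M}. 1 + q ^ i)" if "k \<le> M" for k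
    using that by (subst prod.union_disjoint[symmetric]) (auto intro: prod.cong)
  have prod: "(\<Prod>i\<in>{k<..M}. 1 + q ^ i) * (u * v * (\<Prod>i\<in>{0<..k}. 1 + q ^ i)) * w
      = (\<Prod>i\<in>{0<..M}. 1 + q ^ i) * (u * v * w)" if "k \<le> M" for k u v w
    unfolding split[OF that, symmetric] by (simp only: mult_ac)
  have "(\<Sum>k\<le>M. (\<Prod>i\<in>{k<..M}. 1 + q ^ i) * ((-1) ^ k * q ^ k\<^sup>2 * (\<Prod>i\<in>{0<..k}. 1 + q ^ i)) * (1 - q ^ (2 * k + 1)))
     = (\<Prod>i\<in>{0<..M}. 1 + q ^ i) * (\<Sum>k\<le>M. (-1) ^ k * q ^ k\<^sup>2 * (1 - q ^ (2 * k + 1)))"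
    unfolding sum_distrib_left by (intro sum.cong refl prod) simp
  with rogers_fine_expansion[of q M "-1"] show ?thesis unfolding T by simp
qed

section \<open>Tail sums and the series of the left-hand side\<close>

text \<open>The function \<open>G\<close> of the introductory comment, with sum and products cut off
  at \<open>M\<close>.\<close>

definition tail_sum :: "'a::comm_ring_1 \<Rightarrow> nat \<Rightarrow> 'a \<Rightarrow> 'a" where
  "tail_sum q M z = (\<Sum>s\<le>M. z ^ s * (\<Prod>i\<in>{s<..M}. 1 - q ^ i))"

text \<open>In \<open>tail_sum q M z - tail_sum q M (z * q)\<close> the factor
  \<open>1 - q ^ s\<close> removes \<open>s = 0\<close> and otherwise extends the product by one
  factor; reindexing gives \<open>z\<close> times the sum without its top term.\<close>

lemma tail_sum_shift: "(1 - z) * tail_sum q M z = tail_sum q M (z * q) - z ^ Suc M"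
proof -
  define P where "P s = (\<Prod>i\<in>{s<..M}. 1 - q ^ i)" for s
  have P: "(1 - q ^ Suc s) * P (Suc s) = P s" if "s < M" for s
    using that by (simp add: P_def greaterThanAtMost_Suc_left)
  have "tail_sum q M z - tail_sum q M (z * q) = (\<Sum>s\<le>M. z ^ s * (1 - q ^ s) * P s)"
    by (simp add: tail_sum_def P_def algebra_simps power_mult_distrib flip: sum_subtractf)
  also have "\<dots> = (\<Sum>s<M. z ^ Suc s * ((1 - q ^ Suc s) * P (Suc s)))"
    by (simp add: lessThan_Suc_atMost[symmetric] sum.lessThan_Suc_shift mult.assoc del: sum.lessThan_Suc)
  also have "\<dots> = z * (\<Sum>s<M. z ^ s * P s)"
    by (simp add: P[simplified] sum_distrib_left mult.assoc)
  also have "(\<Sum>s<M. z ^ s * P s) = tail_sum q M z - z ^ M"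
    by (simp add: tail_sum_def P_def lessThan_Suc_atMost[symmetric])
  finally show ?thesis by (simp add: algebra_simps)
qed

text \<open>Apply \<open>tail_sum_shift\<close> repeatedly from \<open>z = - q\<close>; every step
  yields a factor \<open>1 + q ^ i\<close>. After \<open>M\<close> steps only the term
  \<open>s = 0\<close> survives modulo \<open>q ^ M\<close>.\<close>

lemma tail_sum_neg:
  fixes q :: "'a::comm_ring_1"
  shows "q ^ M dvd (\<Prod>i\<in>{0<..M}. 1 + q ^ i) * tail_sum q M (- q) - (\<Prod>i\<in>{0<..M}. 1 - q ^ i)"
proof -
  have "q ^ M dvd (\<Prod>i\<in>{0<..K}. 1 + q ^ i) * tail_sum q M (- q) - tail_sum q M (- (q ^ Suc K))" for K
  proof (induction K)
    case (Suc K)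
    have "q ^ M dvd (- (q ^ Suc K)) ^ Suc M"
      unfolding power_minus[of "q ^ Suc K"] power_mult[symmetric]
      by (intro dvd_mult le_imp_power_dvd) simp
    moreover have "(\<Prod>i\<in>{0<..Suc K}. 1 + q ^ i) * tail_sum q M (- q) - tail_sum q M (- (q ^ Suc (Suc K)))
       = (1 + q ^ Suc K) * ((\<Prod>i\<in>{0<..K}. 1 + q ^ i) * tail_sum q M (- q) - tail_sum q M (- (q ^ Suc K)))
         - (- (q ^ Suc K)) ^ Suc M"
      using tail_sum_shift[of "- (q ^ Suc K)" q M]
      by (simp add: greaterThanAtMost_Suc_right algebra_simps)
    ultimately show ?case
      using Suc by (metis dvd_diff dvd_mult)
  qed simp
  from this[of M] have 1: "q ^ M dvd (\<Prod>i\<in>{0<..M}. 1 + q ^ i) * tail_sum q M (- q) - tail_sum q M (- (q ^ Suc M))" .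
  have "tail_sum q M z = (\<Prod>i\<in>{0<..M}. 1 - q ^ i) + z * (\<Sum>s<M. z ^ s * (\<Prod>i\<in>{Suc s<..M}. 1 - q ^ i))" for z
    by (simp add: tail_sum_def lessThan_Suc_atMost[symmetric] sum.lessThan_Suc_shift sum_distrib_left mult.assoc
        del: sum.lessThan_Suc)
  then have "q ^ M dvd tail_sum q M (- (q ^ Suc M)) - (\<Prod>i\<in>{0<..M}. 1 - q ^ i)"
    by simp
  from dvd_add[OF 1 this] show ?thesis by simp
qed

lemma D2_series:
  fixes q :: "'a::comm_ring_1"
  shows "q ^ M dvd (\<Sum>s\<in>{1..M}. (- q) ^ s * (\<Sum>m\<in>{1..<s}. q ^ m) * (\<Prod>i\<in>{s<..M}. 1 - q ^ i))
     - ((\<Sum>k\<le>M. (-1) ^ k * q ^ pent k * (1 - q ^ (2 * k + 1)))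
        - (\<Sum>k\<le>M. (-1) ^ k * (\<Sum>i<2 * k + 1. q ^ (k\<^sup>2 + i))))"
    (is "_ dvd ?F - (?E - ?S)")
proof -
  define P N X \<theta> where "P = (\<Prod>i\<in>{0<..M}. 1 - q ^ i)" and "N = (\<Prod>i\<in>{0<..M}. 1 + q ^ i)"
    and "X = tail_sum q M (- q)" and "\<theta> = (\<Sum>k\<le>M. (-1) ^ k * q ^ k\<^sup>2 * (1 - q ^ (2 * k + 1)))"
  \<comment> \<open>Both \<open>N * X\<close> and \<open>N * \<theta>\<close> are congruent to
    \<open>P\<close>, and \<open>N\<close> is 1 modulo \<open>q\<close>, so \<open>N\<close>
    cancels.\<close>
  have "q ^ M dvd (N * X - P) + (P - N * \<theta>)"
    unfolding N_def X_def P_def \<theta>_def by (intro dvd_add tail_sum_neg truncated_gauss)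
  then have "q ^ M dvd N * (X - \<theta>)" by (simp add: algebra_simps)
  moreover have "q dvd N - 1"
    unfolding N_def by (rule dvd_prod_minus_one) auto
  ultimately have X: "q ^ M dvd X - \<theta>" by (rule power_dvd_cancel_unit)
  have E: "q ^ M dvd P - ?E"
    unfolding P_def by (rule truncated_pentagonal)
  have S: "(1 - q) * ?S = \<theta>"
    unfolding \<theta>_def sum_distrib_left[of "1 - q"]
  proof (intro sum.cong refl)
    fix k :: nat
    have "(1 - q) * (\<Sum>i<2 * k + 1. q ^ i) = 1 - q ^ (2 * k + 1)"
      by (rule one_diff_power_eq[symmetric])
    moreover have "(\<Sum>i<2 * k + 1. q ^ (k\<^sup>2 + i)) = q ^ k\<^sup>2 * (\<Sum>i<2 * k + 1. q ^ i)"
      by (simp only: power_add sum_distrib_left)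
    ultimately show "(1 - q) * ((-1) ^ k * (\<Sum>i<2 * k + 1. q ^ (k\<^sup>2 + i)))
        = (-1) ^ k * q ^ k\<^sup>2 * (1 - q ^ (2 * k + 1))"
      by (simp only: mult.left_commute[of "1 - q"] mult.assoc)
  qed
  have "(1 - q) * ?F = (\<Sum>s\<in>{1..M}. (- q) ^ s * (q - q ^ s) * (\<Prod>i\<in>{s<..M}. 1 - q ^ i))"
    unfolding sum_distrib_left[of "1 - q"]
  proof (intro sum.cong refl)
    fix s assume "s \<in> {1..M}"
    then have T: "(1 - q) * (\<Sum>m\<in>{1..<s}. q ^ m) = q - q ^ s"
      using sum_Suc_diff'[of 1 s "\<lambda>m. - (q ^ m)"]
      by (simp add: sum_distrib_left algebra_simps)
    show "(1 - q) * ((- q) ^ s * (\<Sum>m\<in>{1..<s}. q ^ m) * (\<Prod>i\<in>{s<..M}. 1 - q ^ i))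
        = (- q) ^ s * (q - q ^ s) * (\<Prod>i\<in>{s<..M}. 1 - q ^ i)"
      unfolding T[symmetric] by (simp only: mult_ac)
  qed
  \<comment> \<open>Expand \<open>q - q ^ s\<close>, using
    \<open>(- q) ^ s * q ^ s = (- q * q) ^ s\<close>. Subtracting \<open>P\<close> removes the term
    \<open>s = 0\<close>.\<close>
  also have "\<dots> = q * (X - P) - (tail_sum q M (- q * q) - P)"
  proof -
    have "tail_sum q M z - P = (\<Sum>s\<in>{1..M}. z ^ s * (\<Prod>i\<in>{s<..M}. 1 - q ^ i))" for z
      by (simp add: tail_sum_def P_def atMost_atLeast0 sum.atLeast_Suc_atMost)
    note this[of "- q * q"] this[of "- q"]
    then show ?thesis
      unfolding X_def sum_distrib_left sum_subtractf[symmetric] power_mult_distrib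
      by (simp only: sum_distrib_left sum_subtractf[symmetric]) (simp only: left_diff_distrib right_diff_distrib mult_ac)
  qed
  also have "tail_sum q M (- q * q) = (1 + q) * X + (- q) ^ Suc M"
    using tail_sum_shift[of "- q" q M] by (simp only: X_def diff_minus_eq_add eq_diff_eq)
  finally have F: "(1 - q) * ?F = q * (X - P) - ((1 + q) * X + (- q) ^ Suc M - P)" .
  have "(1 - q) * (f - (e - s)) = (1 - q) * (p - e) - (x - t) - w"
    if f: "(1 - q) * f = q * (x - p) - ((1 + q) * x + w - p)" and s: "(1 - q) * s = t" for e f p s t w x
  proof -
    have "(1 - q) * (f - (e - s)) = (1 - q) * f - (1 - q) * e + (1 - q) * s"
      by (simp add: algebra_simps)
    also have "\<dots> = (1 - q) * (p - e) - (x - t) - w"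
      unfolding f s by (simp add: algebra_simps)
    finally show ?thesis .
  qed
  note eq = this[OF F S, of ?E]
  have "q ^ M dvd (- q) ^ Suc M"
    unfolding power_minus[of q "Suc M"] by simp
  then have "q ^ M dvd (1 - q) * (?F - (?E - ?S))"
    unfolding eq by (intro dvd_diff dvd_mult X E)
  moreover have "q dvd (1 - q) - 1" by simp
  ultimately show ?thesis by (rule power_dvd_cancel_unit)
qed

section \<open>Partitions sorted by their two smallest parts\<close>

lemma prod_one_minus_power_eq_sum_Pow:
  fixes q :: "'a::comm_ring_1"
  assumes "finite S"
  shows "(\<Prod>i\<in>S. 1 - q ^ i) = (\<Sum>A\<in>Pow S. (-1) ^ card A * q ^ (\<Sum>A))"
  using prod_diff_conv_sum[OF assms, of "\<lambda>_. 1" "\<lambda>i. q ^ i"] by (simp add: power_sum)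

text \<open>With its converse \<open>Min_s2_insert\<close>, this makes removal of the two smallest
  parts a bijection.\<close>

lemma D2_decompose:
  assumes "finite \<pi>" "2 \<le> card \<pi>"
  defines "m \<equiv> Min \<pi>" and "A \<equiv> \<pi> - {Min \<pi>, s2 \<pi>}"
  shows "\<pi> = insert m (insert (s2 \<pi>) A)" "m < s2 \<pi>" "\<And>i. i \<in> A \<Longrightarrow> s2 \<pi> < i"
proof -
  have ne: "\<pi> \<noteq> {}" using assms by auto
  have "card (\<pi> - {m}) \<noteq> 0" using assms ne by (simp add: card_Diff_singleton)
  then have ne': "\<pi> - {m} \<noteq> {}" by force
  have s: "s2 \<pi> \<in> \<pi> - {m}" "\<And>i. i \<in> \<pi> - {m} \<Longrightarrow> s2 \<pi> \<le> i"
    using assms ne' by (auto simp: s2_def m_def simp del: Diff_iff intro: Min_in Min_le)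
  have m: "m \<in> \<pi>" "\<And>i. i \<in> \<pi> \<Longrightarrow> m \<le> i"
    using assms ne by (auto simp: m_def)
  show "\<pi> = insert m (insert (s2 \<pi>) A)" using m s by (auto simp: A_def m_def)
  show "m < s2 \<pi>" using m s by (metis DiffD1 DiffD2 insertI1 le_neq_implies_less)
  show "s2 \<pi> < i" if "i \<in> A" for i
    using that s(2)[of i] by (auto simp: A_def m_def)
qed

lemma Min_s2_insert:
  fixes m s :: nat
  assumes "finite A" "m < s" "\<And>i. i \<in> A \<Longrightarrow> s < i"
  shows "Min (insert m (insert s A)) = m" "s2 (insert m (insert s A)) = s"
proof -
  show M: "Min (insert m (insert s A)) = m"
    using assms(1,2) by (intro Min_eqI) (auto simp: less_imp_le intro: order.trans dest!: assms(3))
  have eq: "insert m (insert s A) - {m} = insert s A" using assms by fastforce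
  show "s2 (insert m (insert s A)) = s"
    unfolding s2_def M eq using assms(1) by (intro Min_eqI) (auto simp: less_imp_le dest!: assms(3))
qed

lemma D2_generating_function:
  fixes q :: "'a::comm_ring_1"
  shows "(\<Sum>\<pi> | \<pi> \<subseteq> {1..M} \<and> 2 \<le> card \<pi>. (-1) ^ (card \<pi> + s2 \<pi>) * q ^ (\<Sum>\<pi>))
     = (\<Sum>s\<in>{1..M}. (- q) ^ s * (\<Sum>m\<in>{1..<s}. q ^ m) * (\<Prod>i\<in>{s<..M}. 1 - q ^ i))"
proof -
  have "(\<Sum>\<pi> | \<pi> \<subseteq> {1..M} \<and> 2 \<le> card \<pi>. (-1) ^ (card \<pi> + s2 \<pi>) * q ^ (\<Sum>\<pi>))
     = (\<Sum>(s, m, A)\<in>(SIGMA s:{1..M}. SIGMA m:{1..<s}. Pow {s<..M}).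
          (- q) ^ s * (q ^ m * ((-1) ^ card A * q ^ (\<Sum>A))))"
  proof (rule sum.reindex_bij_witness[where j = "\<lambda>\<pi>. (s2 \<pi>, Min \<pi>, \<pi> - {Min \<pi>, s2 \<pi>})"
        and i = "\<lambda>(s, m, A). insert m (insert s A)"])
    fix \<pi> assume "\<pi> \<in> {\<pi>. \<pi> \<subseteq> {1..M} \<and> 2 \<le> card \<pi>}"
    then have \<pi>: "\<pi> \<subseteq> {1..M}" "2 \<le> card \<pi>" "finite \<pi>" by (auto dest: finite_subset)
    define m s A where "m = Min \<pi>" and "s = s2 \<pi>" and "A = \<pi> - {m, s}"
    note d = D2_decompose[OF \<pi>(3,2), folded m_def s_def, folded A_def]
    have A: "finite A" "m \<notin> A" "s \<notin> A" using \<pi> by (auto simp: A_def m_def s_def)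
    have c: "card \<pi> = card A + 2" "\<Sum>\<pi> = m + (s + \<Sum>A)"
      using A d(2) by (simp_all add: d(1))
    have "m \<in> \<pi>" "s \<in> \<pi>" "A \<subseteq> \<pi>" using d(1) by auto
    then have "A \<subseteq> {s<..M}" "m \<in> {1..<s}" "s \<in> {1..M}"
      using \<pi>(1) d(2,3) by fastforce+
    then show "(s2 \<pi>, Min \<pi>, \<pi> - {Min \<pi>, s2 \<pi>}) \<in> (SIGMA s:{1..M}. SIGMA m:{1..<s}. Pow {s<..M})"
      unfolding m_def[symmetric] s_def[symmetric] A_def[symmetric] by blast
    show "(case (s2 \<pi>, Min \<pi>, \<pi> - {Min \<pi>, s2 \<pi>}) of (s, m, A) \<Rightarrow> insert m (insert s A)) = \<pi>"
      unfolding m_def[symmetric] s_def[symmetric] A_def[symmetric] using d(1) by simp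
    show "(case (s2 \<pi>, Min \<pi>, \<pi> - {Min \<pi>, s2 \<pi>}) of (s, m, A) \<Rightarrow>
        (- q) ^ s * (q ^ m * ((-1) ^ card A * q ^ (\<Sum>A)))) = (-1) ^ (card \<pi> + s2 \<pi>) * q ^ (\<Sum>\<pi>)"
      \<comment> \<open>The two removed parts leave the parity of the cardinality unchanged, so the
        sign of \<open>s2\<close> can be absorbed into \<open>(- q) ^ s\<close>.\<close>
      unfolding m_def[symmetric] s_def[symmetric] A_def[symmetric] c prod.case power_minus[of q]
      by (simp add: power_add mult_ac)
  next
    fix t assume "t \<in> (SIGMA s:{1..M}. SIGMA m:{1..<s}. Pow {s<..M})"
    then obtain s m A where t: "t = (s, m, A)" "s \<le> M" "1 \<le> m" "m < s" "A \<subseteq> {s<..M}"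
      by auto
    then have A: "finite A" "\<And>i. i \<in> A \<Longrightarrow> s < i" by (auto dest: finite_subset)
    note M = Min_s2_insert[OF A(1) t(4) A(2)]
    have n: "m \<notin> A" "s \<notin> A" using A(2)[of m] A(2)[of s] t(4) by auto
    show "(case (case t of (s, m, A) \<Rightarrow> insert m (insert s A)) of
        \<pi> \<Rightarrow> (s2 \<pi>, Min \<pi>, \<pi> - {Min \<pi>, s2 \<pi>})) = t"
      using n by (auto simp: t(1) M)
    show "(case t of (s, m, A) \<Rightarrow> insert m (insert s A)) \<in> {\<pi>. \<pi> \<subseteq> {1..M} \<and> 2 \<le> card \<pi>}"
      using t n A(1) by (auto dest!: subsetD)
  qed
  also have "\<dots> = (\<Sum>s\<in>{1..M}. \<Sum>m\<in>{1..<s}. \<Sum>A\<in>Pow {s<..M}.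
      (- q) ^ s * (q ^ m * ((-1) ^ card A * q ^ (\<Sum>A))))"
    by (simp add: sum.Sigma case_prod_unfold del: One_nat_def)
  also have "\<dots> = (\<Sum>s\<in>{1..M}. (- q) ^ s * (\<Sum>m\<in>{1..<s}. q ^ m) * (\<Prod>i\<in>{s<..M}. 1 - q ^ i))"
    by (simp add: prod_one_minus_power_eq_sum_Pow mult.assoc del: One_nat_def flip: sum_distrib_left sum_distrib_right)
  finally show ?thesis .
qed

section \<open>Coefficients of the pentagonal series\<close>

lemma coeff_minus_one_power_mult: "coeff ((-1) ^ k * p) n = (-1) ^ k * coeff p n"
  for p :: "'a::comm_ring_1 poly"
  by (induction k) simp_all

text \<open>Successive values of \<open>pent\<close> differ by \<open>3 * k + 2\<close>, which
  exceeds \<open>2 * k + 1\<close>; hence exponents of different indices never coincide.\<close>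

lemma pent_gap: "pent k + (2 * k + 1) < pent k'" if "k < k'"
proof -
  have "pent (Suc k) \<le> pent k'"
  proof (rule lift_Suc_mono_le[where f = pent])
    show "pent i \<le> pent (Suc i)" for i by (simp add: pent_Suc)
    show "Suc k \<le> k'" using that by simp
  qed
  then show ?thesis by (simp add: pent_Suc)
qed

text \<open>The second indicator is the other pentagonal branch: \<open>j (3 j - 1) / 2 = pent k + (2 k + 1)\<close> for
  \<open>j = k + 1\<close>.\<close>

definition pent_coeff :: "nat \<Rightarrow> nat \<Rightarrow> real" where
  "pent_coeff n k = (if pent k = n then 1 else 0) - (if pent k + (2 * k + 1) = n then 1 else 0)"

lemma sum_pent_coeff:
  assumes "j \<le> M" "pent j = n \<or> pent j + (2 * j + 1) = n"
  shows "(\<Sum>k\<le>M. (-1) ^ k * pent_coeff n k) = (-1) ^ j * pent_coeff n j"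
proof -
  have "pent_coeff n k = 0" if "k \<noteq> j" for k
    using that assms(2) pent_gap[of k j] pent_gap[of j k]
    by (cases k j rule: linorder_cases) (auto simp: pent_coeff_def)
  then have "(\<Sum>k\<le>M. (-1) ^ k * pent_coeff n k) = (\<Sum>k\<le>M. if k = j then (-1) ^ j * pent_coeff n j else 0)"
    by (intro sum.cong) auto
  then show ?thesis using assms(1) by simp
qed

text \<open>The second disjunct is \<open>n = j (3 j - 1) / 2\<close> freed of division and
  subtraction.\<close>

lemma sum_pent_coeff_pentagonal:
  assumes "j \<ge> 1" "2 * n = j * (3 * j + 1) \<or> 2 * n + j = j * (3 * j)"
  shows "(\<Sum>k\<le>n. (-1) ^ k * pent_coeff n k) = (-1) ^ j"
  using assms(2)
proof
  assume "2 * n = j * (3 * j + 1)"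
  then have n: "pent j = n" using two_pent[of j] by simp
  have "j * 2 \<le> j * (3 * j + 1)"
    using assms(1) by (intro mult_le_mono2) simp
  then have "j \<le> n" unfolding two_pent[of j, symmetric] n by linarith
  with n show ?thesis using sum_pent_coeff[of j n n] by (simp add: pent_coeff_def)
next
  assume j: "2 * n + j = j * (3 * j)"
  \<comment> \<open>This branch sits at index \<open>j - 1\<close> with coefficient -1, which again
    makes the sign \<open>(-1) ^ j\<close>.\<close>
  obtain i where i: "j = Suc i" using assms(1) by (cases j) auto
  have n: "pent i + (2 * i + 1) = n"
    using two_pent[of i] j by (simp add: i algebra_simps)
  then have "i \<le> n" by simp
  with n show ?thesis using sum_pent_coeff[of i n n] by (simp add: pent_coeff_def i)
qed

lemma sum_pent_coeff_nonpentagonal: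
  assumes "n \<ge> 1" "\<And>j. j \<ge> 1 \<Longrightarrow> 2 * n \<noteq> j * (3 * j + 1) \<and> 2 * n + j \<noteq> j * (3 * j)"
  shows "(\<Sum>k\<le>n. (-1) ^ k * pent_coeff n k) = 0"
proof -
  have "pent_coeff n k = 0" for k
  proof -
    \<comment> \<open>The hypothesis on \<open>j\<close> omits \<open>k = 0\<close>; there
      \<open>pent 0 = 0\<close> and \<open>n \<ge> 1\<close> decide.\<close>
    have "pent k \<noteq> n"
      using assms(1) assms(2)[of k] two_pent[of k] by (cases "k = 0") auto
    moreover have "pent k + (2 * k + 1) \<noteq> n"
      using assms(2)[of "Suc k"] two_pent[of k] by (auto simp: algebra_simps)
    ultimately show ?thesis by (simp add: pent_coeff_def)
  qed
  then show ?thesis by simp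
qed

section \<open>Comparison of coefficients\<close>

text \<open>Take \<open>q\<close> to be the polynomial indeterminate and \<open>M = Suc n\<close>: a
  congruence modulo \<open>q ^ Suc n\<close> fixes the coefficient at \<open>n\<close>.\<close>

lemma D2_sum:
  assumes "l ^ 2 \<le> n" "n < (l + 1) ^ 2"
  shows "(\<Sum>\<pi>\<in>D2 n. (-1::real) powi (int (card \<pi>) - int (s2 \<pi>)))
     = (\<Sum>k\<le>n. (-1) ^ k * pent_coeff n k) - (-1) ^ l"
proof -
  define q :: "real poly" where "q = monom 1 1"
  have q: "q ^ i = monom 1 i" for i by (simp add: q_def monom_power)
  have D2: "D2 n = {\<pi> \<in> {\<pi>. \<pi> \<subseteq> {1..Suc n} \<and> 2 \<le> card \<pi>}. \<Sum>\<pi> = n}"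
  proof (intro equalityI subsetI)
    fix \<pi> assume "\<pi> \<in> D2 n"
    then have \<pi>: "finite \<pi>" "\<forall>p\<in>\<pi>. 0 < p" "\<Sum>\<pi> = n" "2 \<le> card \<pi>" by (auto simp: D2_def)
    have "p \<in> {1..Suc n}" if "p \<in> \<pi>" for p
      using member_le_sum[of p \<pi> "\<lambda>x. x"] that \<pi> by (simp add: Suc_le_eq)
    with \<pi> show "\<pi> \<in> {\<pi> \<in> {\<pi>. \<pi> \<subseteq> {1..Suc n} \<and> 2 \<le> card \<pi>}. \<Sum>\<pi> = n}"
      by blast
  qed (auto simp: D2_def dest: finite_subset)
  have sign: "(-1::real) powi (int (card \<pi>) - int (s2 \<pi>)) = (-1) ^ (card \<pi> + s2 \<pi>)" for \<pi> :: "nat set"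
    by (simp add: power_int_diff power_add minus_one_power_iff)
  have "coeff (\<Sum>\<pi> | \<pi> \<subseteq> {1..Suc n} \<and> 2 \<le> card \<pi>. (-1) ^ (card \<pi> + s2 \<pi>) * q ^ (\<Sum>\<pi>)) n
      = (\<Sum>\<pi> | \<pi> \<subseteq> {1..Suc n} \<and> 2 \<le> card \<pi>. if \<Sum>\<pi> = n then (-1) ^ (card \<pi> + s2 \<pi>) else 0)"
    unfolding coeff_sum coeff_minus_one_power_mult q by (intro sum.cong) auto
  also have "\<dots> = (\<Sum>\<pi>\<in>D2 n. (-1) powi (int (card \<pi>) - int (s2 \<pi>)))"
    unfolding sign D2 by (intro sum.inter_filter[symmetric]) simp
  finally have F: "coeff (\<Sum>\<pi> | \<pi> \<subseteq> {1..Suc n} \<and> 2 \<le> card \<pi>. (-1) ^ (card \<pi> + s2 \<pi>) * q ^ (\<Sum>\<pi>)) n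
      = (\<Sum>\<pi>\<in>D2 n. (-1) powi (int (card \<pi>) - int (s2 \<pi>)))" .
  have E: "coeff (\<Sum>k\<le>Suc n. (-1) ^ k * q ^ pent k * (1 - q ^ (2 * k + 1))) n
      = (\<Sum>k\<le>n. (-1) ^ k * pent_coeff n k)"
  proof -
    have "pent_coeff n (Suc n) = 0" by (simp add: pent_coeff_def pent_Suc)
    moreover have "coeff ((-1) ^ k * q ^ pent k * (1 - q ^ (2 * k + 1))) n = (-1) ^ k * pent_coeff n k" for k
      unfolding mult.assoc coeff_minus_one_power_mult q
      by (simp add: pent_coeff_def mult_monom right_diff_distrib)
    ultimately show ?thesis
      unfolding coeff_sum by (simp only: sum.atMost_Suc mult_zero_right add_0_right)
  qed
  \<comment> \<open>Block \<open>k\<close> covers the exponents from \<open>k\<^sup>2\<close> to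
    \<open>(k + 1)\<^sup>2 - 1\<close>, so \<open>n\<close> lies in block \<open>l\<close>
    alone.\<close>
  have c: "coeff (\<Sum>i<2 * k + 1. q ^ (k\<^sup>2 + i)) n = (if k = l then 1 else 0)" for k
  proof -
    have "k = l" if "k\<^sup>2 \<le> n" "n < (k + 1)\<^sup>2"
    proof -
      have "k\<^sup>2 < (l + 1)\<^sup>2" "l\<^sup>2 < (k + 1)\<^sup>2"
        using that assms by linarith+
      then have "k < l + 1" "l < k + 1"
        using power_less_imp_less_base by blast+
      then show ?thesis by simp
    qed
    then have "k\<^sup>2 \<le> n \<and> n < (k + 1)\<^sup>2 \<longleftrightarrow> k = l"
      using assms by blast
    moreover have "(\<Sum>i<2 * k + 1. if k\<^sup>2 + i = n then 1 else 0 :: real)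
       = (if k\<^sup>2 \<le> n \<and> n < (k + 1)\<^sup>2 then 1 else 0)"
    proof (cases "k\<^sup>2 \<le> n")
      case True
      then obtain d where "n = k\<^sup>2 + d" using le_Suc_ex by blast
      then show ?thesis by (simp add: power2_sum del: sum.lessThan_Suc) (auto simp: power2_eq_square)
    next
      case False
      then show ?thesis by (intro trans[OF sum.neutral]) auto
    qed
    ultimately show ?thesis
      unfolding coeff_sum q coeff_monom by (simp only:)
  qed
  have "l \<le> n"
    using assms(1) le_square[of l] unfolding power2_eq_square by linarith
  then have S: "coeff (\<Sum>k\<le>Suc n. (-1) ^ k * (\<Sum>i<2 * k + 1. q ^ (k\<^sup>2 + i))) n = (-1) ^ l"
    unfolding coeff_sum[of _ "{..Suc n}"] coeff_minus_one_power_mult c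
    by (simp add: if_distrib cong: if_cong)
  have "monom 1 (Suc n) dvd (\<Sum>\<pi> | \<pi> \<subseteq> {1..Suc n} \<and> 2 \<le> card \<pi>. (-1) ^ (card \<pi> + s2 \<pi>) * q ^ (\<Sum>\<pi>))
      - ((\<Sum>k\<le>Suc n. (-1) ^ k * q ^ pent k * (1 - q ^ (2 * k + 1)))
         - (\<Sum>k\<le>Suc n. (-1) ^ k * (\<Sum>i<2 * k + 1. q ^ (k\<^sup>2 + i))))"
    using D2_series[of q "Suc n"] unfolding D2_generating_function q[of "Suc n"] .
  then have "coeff \<dots> n = 0"
    unfolding monom_1_dvd_iff' by blast
  then show ?thesis
    unfolding coeff_diff E F S by simp
qed

theorem theorem3p7:
  fixes n l :: nat
  assumes "n \<ge> 1" and "l \<ge> 1" and "l ^ 2 \<le> n" and "n < (l + 1) ^ 2"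
  shows "(\<forall>j::nat. j \<ge> 1 \<and>
            (real n = real j * (3 * real j + 1) / 2 \<or> real n = real j * (3 * real j - 1) / 2) \<longrightarrow>
            (\<Sum>\<pi>\<in>D2 n. (-1::real) powi (int (card \<pi>) - int (s2 \<pi>))) = (-1) ^ (l - 1) + (-1) ^ j) \<and>
         ((\<nexists>j::nat. j \<ge> 1 \<and>
            (real n = real j * (3 * real j + 1) / 2 \<or> real n = real j * (3 * real j - 1) / 2)) \<longrightarrow>
            (\<Sum>\<pi>\<in>D2 n. (-1::real) powi (int (card \<pi>) - int (s2 \<pi>))) = (-1) ^ (l - 1))"
proof -
  \<comment> \<open>Clearing denominators and moving \<open>j\<close> across turns both forms into
    equations over the naturals without truncated subtraction.\<close>
  have "real n = real j * (3 * real j + 1) / 2 \<longleftrightarrow> real (2 * n) = real (j * (3 * j + 1))" for j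
    by (auto simp: field_simps)
  moreover have "real n = real j * (3 * real j - 1) / 2 \<longleftrightarrow> real (2 * n + j) = real (j * (3 * j))" for j
    by (auto simp: field_simps)
  ultimately have pentagonal: "real n = real j * (3 * real j + 1) / 2 \<or> real n = real j * (3 * real j - 1) / 2
      \<longleftrightarrow> 2 * n = j * (3 * j + 1) \<or> 2 * n + j = j * (3 * j)" for j
    by (metis of_nat_eq_iff)
  have "(-1::real) ^ l = - ((-1) ^ (l - 1))"
    using assms(2) by (cases l) simp_all
  then have D2: "(\<Sum>\<pi>\<in>D2 n. (-1::real) powi (int (card \<pi>) - int (s2 \<pi>)))
      = (-1) ^ (l - 1) + (\<Sum>k\<le>n. (-1) ^ k * pent_coeff n k)"
    using D2_sum[OF assms(3,4)] by simp
  show ?thesis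
    unfolding pentagonal D2
  proof (intro conjI allI impI)
    fix j assume "1 \<le> j \<and> (2 * n = j * (3 * j + 1) \<or> 2 * n + j = j * (3 * j))"
    then have "(\<Sum>k\<le>n. (-1) ^ k * pent_coeff n k) = (-1) ^ j"
      by (intro sum_pent_coeff_pentagonal) simp_all
    then show "(-1) ^ (l - 1) + (\<Sum>k\<le>n. (-1) ^ k * pent_coeff n k) = (-1) ^ (l - 1) + (-1) ^ j"
      by simp
  next
    assume "\<nexists>j. 1 \<le> j \<and> (2 * n = j * (3 * j + 1) \<or> 2 * n + j = j * (3 * j))"
    then have "(\<Sum>k\<le>n. (-1) ^ k * pent_coeff n k) = 0"
      by (intro sum_pent_coeff_nonpentagonal assms(1)) blast
    then show "(-1) ^ (l - 1) + (\<Sum>k\<le>n. (-1) ^ k * pent_coeff n k) = (-1) ^ (l - 1)"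
      by simp
  qed
qed

end
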